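(* Let $\mu_0,\mu_f\in\mathcal{P}(\mathbb{R}^d)$ and suppose that the matrix $G_{t_f,0}$ is invertible. Let $z=(x_0,x_f)\sim\mu_0\otimes\mu_f$. Then the parameter-independent control process $$u(t)=u^z(t):=\Phi(t_f,t)^{\mathrm T}G_{t_f,0}^{-1}\left(x_f-\left(\int_0^1 e^{A(\theta)t_f}\,d\theta\right)x_0\right),\qquad t\in[0,t_f],$$ solves the distributional averaged control problem for $(\mu_0,\mu_f)$ in the noiseless case: it steers the ensemble of states from $X(0,\theta)=x_0\sim\mu_0$, for all $\theta\in[0,1]$, to $\int_0^1 X(t_f,\theta)\,d\theta\sim\mu_f$.
   Context: Fix $t_f>0$, $A\in C([0,1];\mathbb{R}^{d\times d})$ and $B\in C([0,1];\mathbb{R}^{d\times m})$. $\mathcal{P}(\mathbb{R}^d)$ denotes the set of Borel probability measures on $\mathbb{R}^d$. The noiseless ensemble of linear systems is $\frac{d}{dt}X(t,\theta)=A(\theta)X(t,\theta)+B(\theta)u(t)$, $\theta\in[0,1]$, where $u$ does not depend on $\theta$. Distributional averaged control problem (noiseless case): given $(\mu_0,\mu_f)\in\mathcal{P}(\mathbb{R}^d)\times\mathcal{P}(\mathbb{R}^d)$, find a parameter-independent control process $u\in L^2([0,t_f];\mathbb{R}^m)$ that steers the ensemble of states from $X(0,\theta)\sim\mu_0$, for all $\theta\in[0,1]$, to $\int_0^1 X(t_f,\theta)\,d\theta\sim\mu_f$. Here all members of the ensemble start from the same random point, $X(0,\theta)=x_0$ for all $\theta$. Notation: $\Phi(t,\tau):=\int_0^1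 e^{A(\theta)(t-\tau)}B(\theta)\,d\theta$ for $0\le\tau\le t\le t_f$, and $G_{t_f,0}:=\int_0^{t_f}\Phi(t_f,\tau)\Phi(t_f,\tau)^{\mathrm T}\,d\tau$. *)

theory Defs
  imports "HOL-Probability.Probability"
begin

text \<open>The product \<open>*\<close> on the type of square matrices is componentwise and the library has no
  exponential for matrices, so the usual power series is spelled out with the matrix product.\<close>

definition matrix_exp :: "real^'n^'n \<Rightarrow> real^'n^'n" where
  "matrix_exp M = (\<Sum>k. (1 / fact k) *\<^sub>R (((**) M ^^ k) (mat 1)))"

definition averaged_response ::
    "(real \<Rightarrow> real^'d^'d) \<Rightarrow> (real \<Rightarrow> real^'m^'d) \<Rightarrow> real \<Rightarrow> real \<Rightarrow> real^'m^'d" where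
  "averaged_response A B t \<tau> =
     integral {0..1} (\<lambda>\<theta>. matrix_exp ((t - \<tau>) *\<^sub>R A \<theta>) ** B \<theta>)"

definition averaged_gramian ::
    "(real \<Rightarrow> real^'d^'d) \<Rightarrow> (real \<Rightarrow> real^'m^'d) \<Rightarrow> real \<Rightarrow> real^'d^'d" where
  "averaged_gramian A B t\<^sub>f =
     integral {0..t\<^sub>f} (\<lambda>\<tau>. averaged_response A B t\<^sub>f \<tau> ** transpose (averaged_response A B t\<^sub>f \<tau>))"

definition averaged_control ::
    "(real \<Rightarrow> real^'d^'d) \<Rightarrow> (real \<Rightarrow> real^'m^'d) \<Rightarrow> real \<Rightarrow> (real^'d) \<times> (real^'d) \<Rightarrow> real \<Rightarrow> real^'m"
  where
  "averaged_control A B t\<^sub>f z t =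
     (case z of (x\<^sub>0, x\<^sub>f) \<Rightarrow>
        (transpose (averaged_response A B t\<^sub>f t) ** matrix_inv (averaged_gramian A B t\<^sub>f))
          *v (x\<^sub>f - integral {0..1} (\<lambda>\<theta>. matrix_exp (t\<^sub>f *\<^sub>R A \<theta>)) *v x\<^sub>0))"

definition square_integrable_on :: "(real \<Rightarrow> 'a::euclidean_space) \<Rightarrow> real set \<Rightarrow> bool"
    (infixr \<open>square'_integrable'_on\<close> 46) where
  "u square_integrable_on S \<longleftrightarrow>
     u \<in> borel_measurable (lebesgue_on S) \<and> integrable (lebesgue_on S) (\<lambda>t. (norm (u t))\<^sup>2)"

text \<open>Solutions of \<open>x' = P x + Q u\<close> on \<open>[0, t\<^sub>f]\<close>. Controls are only square integrable in time, so
  the equation is understood in the sense of Caratheodory: \<open>x\<close> is absolutely continuous with the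
  prescribed derivative almost everywhere, i.e. \<open>x\<close> is an indefinite Lebesgue integral of
  \<open>P x + Q u\<close>. For continuous \<open>u\<close> these are exactly the classical solutions, see
  \<open>linear_control_solution_iff_classical\<close> below.\<close>

definition linear_control_solution ::
    "real^'d^'d \<Rightarrow> real^'m^'d \<Rightarrow> real \<Rightarrow> (real \<Rightarrow> real^'m) \<Rightarrow> (real \<Rightarrow> real^'d) \<Rightarrow> bool" where
  "linear_control_solution P Q t\<^sub>f u x \<longleftrightarrow>
     (\<lambda>s. P *v x s + Q *v u s) absolutely_integrable_on {0..t\<^sub>f} \<and>
     (\<forall>t\<in>{0..t\<^sub>f}. x t = x 0 + integral {0..t} (\<lambda>s. P *v x s + Q *v u s))"

text \<open>Control processes on the probability space \<open>M\<close>: jointly measurable, with sample paths in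
  \<open>L\<^sup>2([0, t\<^sub>f])\<close>.\<close>

definition control_process ::
    "'w measure \<Rightarrow> real \<Rightarrow> ('w \<Rightarrow> real \<Rightarrow> real^'m) \<Rightarrow> bool" where
  "control_process M t\<^sub>f u \<longleftrightarrow>
     case_prod u \<in> borel_measurable (M \<Otimes>\<^sub>M restrict_space borel {0..t\<^sub>f}) \<and>
     (\<forall>\<omega>\<in>space M. u \<omega> square_integrable_on {0..t\<^sub>f})"

text \<open>\<open>X \<omega> t \<theta>\<close> is the state of system \<open>\<theta>\<close> at time \<open>t\<close>. The control \<open>u\<close> and the random starting
  point \<open>x\<^sub>0\<close> are shared by all members of the ensemble.\<close>

definition ensemble_states ::
    "(real \<Rightarrow> real^'d^'d) \<Rightarrow> (real \<Rightarrow> real^'m^'d) \<Rightarrow> real \<Rightarrow> 'w measure \<Rightarrow>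
     ('w \<Rightarrow> real^'d) \<Rightarrow> ('w \<Rightarrow> real \<Rightarrow> real^'m) \<Rightarrow> ('w \<Rightarrow> real \<Rightarrow> real \<Rightarrow> real^'d) \<Rightarrow> bool" where
  "ensemble_states A B t\<^sub>f M x\<^sub>0 u X \<longleftrightarrow>
     (\<forall>\<omega>\<in>space M. \<forall>\<theta>\<in>{0..1}.
        X \<omega> 0 \<theta> = x\<^sub>0 \<omega> \<and> linear_control_solution (A \<theta>) (B \<theta>) t\<^sub>f (u \<omega>) (\<lambda>t. X \<omega> t \<theta>))"

text \<open>The control determines the states uniquely on \<open>[0, t\<^sub>f] \<times> [0, 1]\<close>. Steering is required of
  every family of states satisfying the equations, together with the existence of such a family.
  Integrability of the average and measurability are explicit because \<open>integral\<close> and \<open>distr\<close> are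
  total functions.\<close>

definition solves_averaged_control_problem ::
    "(real \<Rightarrow> real^'d^'d) \<Rightarrow> (real \<Rightarrow> real^'m^'d) \<Rightarrow> real \<Rightarrow> (real^'d) measure \<Rightarrow> (real^'d) measure \<Rightarrow>
     'w measure \<Rightarrow> ('w \<Rightarrow> real^'d) \<Rightarrow> ('w \<Rightarrow> real \<Rightarrow> real^'m) \<Rightarrow> bool" where
  "solves_averaged_control_problem A B t\<^sub>f \<mu>\<^sub>0 \<mu>\<^sub>f M x\<^sub>0 u \<longleftrightarrow>
     control_process M t\<^sub>f u \<and>
     x\<^sub>0 \<in> borel_measurable M \<and> distr M borel x\<^sub>0 = \<mu>\<^sub>0 \<and>
     (\<exists>X. ensemble_states A B t\<^sub>f M x\<^sub>0 u X) \<and>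
     (\<forall>X. ensemble_states A B t\<^sub>f M x\<^sub>0 u X \<longrightarrow>
        (\<forall>\<omega>\<in>space M. X \<omega> t\<^sub>f absolutely_integrable_on {0..1}) \<and>
        (\<lambda>\<omega>. integral {0..1} (X \<omega> t\<^sub>f)) \<in> borel_measurable M \<and>
        distr M borel (\<lambda>\<omega>. integral {0..1} (X \<omega> t\<^sub>f)) = \<mu>\<^sub>f)"

lemma linear_control_solution_iff_classical:
  fixes P :: "real^'d^'d" and Q :: "real^'m^'d"
  assumes u: "continuous_on {0..t\<^sub>f} u"
  shows "linear_control_solution P Q t\<^sub>f u x \<longleftrightarrow>
    (\<forall>t\<in>{0..t\<^sub>f}. (x has_vector_derivative P *v x t + Q *v u t) (at t within {0..t\<^sub>f}))"
proof -
  let ?f = "\<lambda>s. P *v x s + Q *v u s"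
  have cont: "continuous_on {0..t\<^sub>f} ?f" if "continuous_on {0..t\<^sub>f} x"
    using that u
    by (intro continuous_on_add bounded_linear.continuous_on[OF matrix_vector_mul_bounded_linear])
  show ?thesis
  proof (intro iffI ballI)
    fix t assume L: "linear_control_solution P Q t\<^sub>f u x" and t: "t \<in> {0..t\<^sub>f}"
    have ai: "?f integrable_on {0..t\<^sub>f}"
      using L unfolding linear_control_solution_def
      by (blast dest: set_lebesgue_integral_eq_integral(1))
    have eq: "x t = x 0 + integral {0..t} ?f" if "t \<in> {0..t\<^sub>f}" for t
      using L that unfolding linear_control_solution_def by blast
    have "continuous_on {0..t\<^sub>f} (\<lambda>t. x 0 + integral {0..t} ?f)"
      by (intro continuous_on_add continuous_on_const indefinite_integral_continuous_1 ai)
    then have "continuous_on {0..t\<^sub>f} x"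
      by (rule continuous_on_eq) (rule eq[symmetric])
    then have "((\<lambda>t. integral {0..t} ?f) has_vector_derivative ?f t) (at t within {0..t\<^sub>f})"
      using t by (intro integral_has_vector_derivative cont)
    then have "((\<lambda>t. x 0 + integral {0..t} ?f) has_vector_derivative 0 + ?f t) (at t within {0..t\<^sub>f})"
      by (intro has_vector_derivative_add has_vector_derivative_const)
    then have "((\<lambda>t. x 0 + integral {0..t} ?f) has_vector_derivative ?f t) (at t within {0..t\<^sub>f})"
      by (simp only: add_0)
    then show "(x has_vector_derivative ?f t) (at t within {0..t\<^sub>f})"
      using t eq by (rule has_vector_derivative_transform[rotated 2])
  next
    assume R: "\<forall>t\<in>{0..t\<^sub>f}. (x has_vector_derivative ?f t) (at t within {0..t\<^sub>f})"
    then have "continuous_on {0..t\<^sub>f} x"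
      by (intro continuous_on_vector_derivative) (rule bspec)
    then have "?f absolutely_integrable_on {0..t\<^sub>f}"
      by (intro absolutely_integrable_continuous_real cont)
    moreover have "x t = x 0 + integral {0..t} ?f" if t: "t \<in> {0..t\<^sub>f}" for t
    proof -
      have "(?f has_integral x t - x 0) {0..t}"
      proof (rule fundamental_theorem_of_calculus)
        show "0 \<le> t" using t by simp
        fix s assume s: "s \<in> {0..t}"
        have s': "s \<in> {0..t\<^sub>f}" and sub: "{0..t} \<subseteq> {0..t\<^sub>f}" using s t by auto
        from R s' have "(x has_vector_derivative ?f s) (at s within {0..t\<^sub>f})" by (rule bspec)
        then show "(x has_vector_derivative ?f s) (at s within {0..t})"
          using sub by (rule has_vector_derivative_within_subset)
      qed
      then have "integral {0..t} ?f = x t - x 0"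
        by (rule integral_unique)
      then show ?thesis by (simp only: add_diff_eq add_diff_cancel_left')
    qed
    ultimately show "linear_control_solution P Q t\<^sub>f u x"
      unfolding linear_control_solution_def by (intro conjI ballI)
  qed
qed

end

theory Submission
  imports Defs
begin

text \<open>By variation of constants and Fubini, the average over \<open>\<theta>\<close> of the states at time \<open>t\<^sub>f\<close> is
  \<open>(\<integral> exp(t\<^sub>f A(\<theta>)) d\<theta>) x\<^sub>0 + \<integral> \<Phi>(t\<^sub>f, \<tau>) u(\<tau>) d\<tau>\<close>. Inserting the control turns the second integral
  into \<open>G G\<^sup>-\<^sup>1 (x\<^sub>f - (\<integral> exp(t\<^sub>f A(\<theta>)) d\<theta>) x\<^sub>0)\<close>, so the average equals \<open>x\<^sub>f\<close> for every sample, and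
  its law is the second marginal of the law of \<open>z\<close>.\<close>

section \<open>The matrix exponential\<close>

text \<open>In finite dimension bilinearity already gives boundedness. Continuity, product rules and
  termwise multiplication of series are all drawn from this fact.\<close>

lemma bounded_bilinear_matrix_matrix_mult:
  "bounded_bilinear ((**) :: real^'n^'m \<Rightarrow> real^'p^'n \<Rightarrow> real^'p^'m)"
  unfolding bilinear_conv_bounded_bilinear[symmetric] bilinear_def
  by (auto intro!: linearI simp: matrix_matrix_mult_def vec_eq_iff sum.distrib algebra_simps
      sum_distrib_left)

lemma bounded_bilinear_matrix_vector_mult:
  "bounded_bilinear ((*v) :: real^'n^'m \<Rightarrow> real^'n \<Rightarrow> real^'m)"
  unfolding bilinear_conv_bounded_bilinear[symmetric] bilinear_def
  by (auto intro!: linearI simp: matrix_vector_mult_def vec_eq_iff sum.distrib algebra_simps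
      sum_distrib_left)

lemma bounded_linear_transpose: "bounded_linear (transpose :: real^'n^'m \<Rightarrow> real^'m^'n)"
  unfolding linear_conv_bounded_linear[symmetric]
  by (auto intro!: linearI simp: transpose_def vec_eq_iff)

lemmas continuous_on_matrix_matrix_mult [continuous_intros] =
  bounded_bilinear.continuous_on[OF bounded_bilinear_matrix_matrix_mult]

lemmas continuous_on_matrix_vector_mult [continuous_intros] =
  bounded_bilinear.continuous_on[OF bounded_bilinear_matrix_vector_mult]

lemmas continuous_on_transpose [continuous_intros] =
  bounded_linear.continuous_on[OF bounded_linear_transpose]

section \<open>Powers of a matrix and convergence of the exponential series\<close>

abbreviation matrix_power :: "real^'n^'n \<Rightarrow> nat \<Rightarrow> real^'n^'n" where
  "matrix_power M k \<equiv> ((**) M ^^ k) (mat 1)"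

lemma matrix_power_commute: "M ** matrix_power M k = matrix_power M k ** M"
  by (induction k) (auto simp: matrix_mul_assoc)

lemma matrix_power_scaleR: "matrix_power (c *\<^sub>R M) k = c ^ k *\<^sub>R matrix_power M k"
  by (induction k) (auto simp: bounded_bilinear.scaleR_left[OF bounded_bilinear_matrix_matrix_mult]
      bounded_bilinear.scaleR_right[OF bounded_bilinear_matrix_matrix_mult])

text \<open>Submultiplicativity of the norm is used only up to the constant \<open>K\<close> of the
  bounded bilinear product. The constant \<open>C\<close> is the norm of \<open>mat 1\<close>, which
  need not be 1.\<close>

lemma matrix_power_bound:
  obtains C K :: real where "C \<ge> 0" "K > 0"
    "\<And>(M :: real^'n^'n) k. norm (matrix_power M k) \<le> C * (K * norm M) ^ k"
proof -
  obtain K where K: "K > 0" "\<And>(M :: real^'n^'n) (N :: real^'n^'n). norm (M ** N) \<le> norm M * norm N * K"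
    using bounded_bilinear.pos_bounded[OF bounded_bilinear_matrix_matrix_mult] by metis
  have "norm (matrix_power M k) \<le> norm (mat 1 :: real^'n^'n) * (K * norm M) ^ k"
    for M :: "real^'n^'n" and k
  proof (induction k)
    case (Suc k)
    have "norm (matrix_power M (Suc k)) \<le> norm M * norm (matrix_power M k) * K"
      using K(2) by simp
    also have "\<dots> \<le> norm M * (norm (mat 1 :: real^'n^'n) * (K * norm M) ^ k) * K"
      using K(1) by (intro mult_right_mono mult_left_mono Suc) auto
    finally show ?case by (simp add: algebra_simps)
  qed simp
  with that K(1) show ?thesis by (meson norm_ge_zero)
qed

text \<open>The majorant, a multiple of the exponential series at \<open>K * r\<close>, depends on
  \<open>M\<close> only through \<open>r\<close>. It therefore serves both convergence at a single
  matrix and uniform convergence on balls.\<close>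

lemma matrix_exp_term_bound:
  fixes r :: real
  shows "\<exists>a. summable a \<and>
    (\<forall>(M :: real^'n^'n) k. norm M \<le> r \<longrightarrow> norm ((1 / fact k) *\<^sub>R matrix_power M k) \<le> a k)"
proof -
  obtain C K :: real where CK: "C \<ge> 0" "K > 0"
    "\<And>(M :: real^'n^'n) k. norm (matrix_power M k) \<le> C * (K * norm M) ^ k"
    using matrix_power_bound[where 'n='n] by blast
  show ?thesis
  proof (intro exI conjI allI impI)
    show "summable (\<lambda>k. C * (inverse (fact k) * (K * r) ^ k))"
      by (intro summable_mult summable_exp)
    fix M :: "real^'n^'n" and k :: nat
    assume "norm M \<le> r"
    then have "C * (K * norm M) ^ k \<le> C * (K * r) ^ k"
      using CK by (intro mult_left_mono power_mono mult_nonneg_nonneg) auto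
    with CK(3)[of k M] have "norm (matrix_power M k) \<le> C * (K * r) ^ k"
      by linarith
    then show "norm ((1 / fact k) *\<^sub>R matrix_power M k) \<le> C * (inverse (fact k) * (K * r) ^ k)"
      by (simp add: field_simps)
  qed
qed

lemma matrix_exp_sums:
  fixes M :: "real^'n^'n"
  shows "(\<lambda>k. (1 / fact k) *\<^sub>R matrix_power M k) sums matrix_exp M"
proof -
  obtain a where "summable a" "\<And>k. norm ((1 / fact k) *\<^sub>R matrix_power M k) \<le> a k"
    using matrix_exp_term_bound[where 'n='n, of "norm M"] by (metis order_refl)
  then have "summable (\<lambda>k. (1 / fact k) *\<^sub>R matrix_power M k)"
    by (rule summable_comparison_test'[of a 0])
  then show ?thesis
    unfolding matrix_exp_def by (rule summable_sums)
qed

text \<open>By the Weierstrass test the continuous partial sums converge uniformly on each ball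
  around 0, and every matrix is interior to such a ball.\<close>

lemma continuous_on_matrix_exp_UNIV: "continuous_on UNIV (matrix_exp :: real^'n^'n \<Rightarrow> _)"
proof -
  have pow: "continuous_on S (\<lambda>M :: real^'n^'n. matrix_power M k)" for S k
    by (induction k) (auto intro!: continuous_intros)
  have "continuous_on (cball 0 r) (matrix_exp :: real^'n^'n \<Rightarrow> _)" for r
  proof -
    obtain a where a: "summable a"
      "\<And>(M :: real^'n^'n) k. norm M \<le> r \<Longrightarrow> norm ((1 / fact k) *\<^sub>R matrix_power M k) \<le> a k"
      using matrix_exp_term_bound[where 'n='n, of r] by blast
    show ?thesis
    proof (rule uniform_limit_theorem)
      show "uniform_limit (cball 0 r) (\<lambda>n M. \<Sum>k<n. (1 / fact k) *\<^sub>R matrix_power M k)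
          (matrix_exp :: real^'n^'n \<Rightarrow> _) sequentially"
        unfolding matrix_exp_def by (rule Weierstrass_m_test) (use a in auto)
    qed (auto intro!: always_eventually continuous_intros pow)
  qed
  then have "isCont (matrix_exp :: real^'n^'n \<Rightarrow> _) M" for M
    by (rule continuous_on_interior[of "cball 0 (norm M + 1)"]) auto
  then show ?thesis
    by (simp add: continuous_at_imp_continuous_on)
qed

lemma continuous_on_matrix_exp [continuous_intros]:
  "continuous_on S f \<Longrightarrow> continuous_on S (\<lambda>x. matrix_exp (f x))"
  by (rule continuous_on_compose2[OF continuous_on_matrix_exp_UNIV]) auto

lemma matrix_exp_0 [simp]: "matrix_exp (0 :: real^'n^'n) = mat 1"
proof -
  have "(\<lambda>k. (1 / fact k) *\<^sub>R matrix_power (0 :: real^'n^'n) k) = (\<lambda>k. if k = 0 then mat 1 else 0)"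
    by (auto simp: fun_eq_iff bounded_bilinear.zero_left[OF bounded_bilinear_matrix_matrix_mult]
        gr0_conv_Suc)
  then have "(\<lambda>k. if k = 0 then mat 1 else 0) sums matrix_exp (0 :: real^'n^'n)"
    using matrix_exp_sums[of "0 :: real^'n^'n"] by simp
  then show ?thesis
    using sums_single[of 0 "\<lambda>_. mat 1 :: real^'n^'n"] by (rule sums_unique2)
qed

section \<open>Commutation, derivative and inverse of the exponential\<close>

lemma matrix_exp_commute: "M ** matrix_exp M = matrix_exp M ** M"
proof -
  have "(\<lambda>k. M ** ((1 / fact k) *\<^sub>R matrix_power M k)) sums (M ** matrix_exp M)"
    by (intro bounded_linear.sums[OF bounded_bilinear.bounded_linear_right
          [OF bounded_bilinear_matrix_matrix_mult]] matrix_exp_sums)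
  moreover have "(\<lambda>k. ((1 / fact k) *\<^sub>R matrix_power M k) ** M) sums (matrix_exp M ** M)"
    by (intro bounded_linear.sums[OF bounded_bilinear.bounded_linear_left
          [OF bounded_bilinear_matrix_matrix_mult]] matrix_exp_sums)
  ultimately show ?thesis
    by (simp add: bounded_bilinear.scaleR_left[OF bounded_bilinear_matrix_matrix_mult]
        bounded_bilinear.scaleR_right[OF bounded_bilinear_matrix_matrix_mult]
        matrix_power_commute sums_unique2)
qed

lemma matrix_exp_scaleR_commute: "M ** matrix_exp (t *\<^sub>R M) = matrix_exp (t *\<^sub>R M) ** M"
\<comment> \<open>For nonzero \<open>t\<close> the scalar cancels from the commutation of
  \<open>t *\<^sub>R M\<close> with its exponential; for \<open>t = 0\<close> the exponential is the
  identity.\<close>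
proof (cases "t = 0")
  case False
  then show ?thesis
    using matrix_exp_commute[of "t *\<^sub>R M"]
    by (simp add: bounded_bilinear.scaleR_left[OF bounded_bilinear_matrix_matrix_mult]
        bounded_bilinear.scaleR_right[OF bounded_bilinear_matrix_matrix_mult])
qed simp

text \<open>Pairing with a basis element \<open>b\<close> turns the matrix series into a scalar
  power series in \<open>t\<close>, which may be differentiated term by term. The components
  together determine the derivative.\<close>

lemma has_vector_derivative_matrix_exp_scaleR:
  fixes M :: "real^'n^'n"
  shows "((\<lambda>t. matrix_exp (t *\<^sub>R M)) has_vector_derivative M ** matrix_exp (t *\<^sub>R M)) (at t)"
  unfolding has_vector_derivative_def
proof (rule has_derivative_componentwise_within[THEN iffD2], rule ballI)
  fix b :: "real^'n^'n"
  define c where "c k = (matrix_power M k \<bullet> b) / fact k" for k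
  have sums: "(\<lambda>k. c k * s ^ k) sums (matrix_exp (s *\<^sub>R M) \<bullet> b)" for s
    using bounded_linear.sums[OF bounded_linear_inner_left matrix_exp_sums, of "s *\<^sub>R M" b]
    by (simp add: matrix_power_scaleR c_def mult.commute)
  have "(\<lambda>k. M ** ((1 / fact k) *\<^sub>R matrix_power (t *\<^sub>R M) k)) sums (M ** matrix_exp (t *\<^sub>R M))"
    by (intro bounded_linear.sums[OF bounded_bilinear.bounded_linear_right
          [OF bounded_bilinear_matrix_matrix_mult]] matrix_exp_sums)
  then have "(\<lambda>k. (M ** ((1 / fact k) *\<^sub>R matrix_power (t *\<^sub>R M) k)) \<bullet> b)
      sums ((M ** matrix_exp (t *\<^sub>R M)) \<bullet> b)"
    by (rule bounded_linear.sums[OF bounded_linear_inner_left])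
  \<comment> \<open>\<open>diffs c k\<close> is \<open>Suc k\<close> times \<open>c (Suc k)\<close>;
    the factor cancels in \<open>fact (Suc k)\<close> and leaves the power \<open>Suc k\<close> of
    \<open>M\<close> over \<open>fact k\<close>.\<close>
  moreover have "(M ** ((1 / fact k) *\<^sub>R matrix_power (t *\<^sub>R M) k)) \<bullet> b = diffs c k * t ^ k" for k
    by (simp add: matrix_power_scaleR diffs_def c_def
        bounded_bilinear.scaleR_right[OF bounded_bilinear_matrix_matrix_mult] del: of_nat_Suc)
  ultimately have "(\<Sum>k. diffs c k * t ^ k) = (M ** matrix_exp (t *\<^sub>R M)) \<bullet> b"
    by (simp add: sums_iff)
  moreover have "((\<lambda>s. \<Sum>k. c k * s ^ k) has_field_derivative (\<Sum>k. diffs c k * t ^ k)) (at t)"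
    by (rule termdiffs_strong_converges_everywhere) (use sums in \<open>auto simp: sums_iff\<close>)
  moreover have "(\<lambda>s. \<Sum>k. c k * s ^ k) = (\<lambda>s. matrix_exp (s *\<^sub>R M) \<bullet> b)"
    using sums by (auto simp: sums_iff)
  ultimately have "((\<lambda>s. matrix_exp (s *\<^sub>R M) \<bullet> b) has_field_derivative
      (M ** matrix_exp (t *\<^sub>R M)) \<bullet> b) (at t)"
    by simp
  then show "((\<lambda>s. matrix_exp (s *\<^sub>R M) \<bullet> b) has_derivative
      (\<lambda>h. (h *\<^sub>R (M ** matrix_exp (t *\<^sub>R M))) \<bullet> b)) (at t)"
    by (simp add: has_field_derivative_def mult.commute[of _ "(M ** _) \<bullet> b"])
qed

text \<open>Commutation moves \<open>M\<close> to the right of the exponential, where it can meet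
  the homogeneous term \<open>P *v x s\<close> of the equation when \<open>M\<close> is
  \<open>P\<close>.\<close>

lemma has_vector_derivative_matrix_exp_diff:
  fixes M :: "real^'n^'n"
  shows "((\<lambda>s. matrix_exp ((T - s) *\<^sub>R M)) has_vector_derivative
    - (matrix_exp ((T - s) *\<^sub>R M) ** M)) (at s within S)"
proof -
  have "((\<lambda>s. T - s) has_real_derivative -1) (at s within S)"
    by (auto intro!: derivative_eq_intros)
  then have "((\<lambda>s. T - s) has_vector_derivative -1) (at s within S)"
    by (simp add: has_real_derivative_iff_has_vector_derivative)
  then have "((\<lambda>t. matrix_exp (t *\<^sub>R M)) \<circ> (\<lambda>s. T - s) has_vector_derivative
      (-1) *\<^sub>R (M ** matrix_exp ((T - s) *\<^sub>R M))) (at s within S)"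
    by (rule vector_diff_chain_within)
      (rule has_vector_derivative_at_within, rule has_vector_derivative_matrix_exp_scaleR)
  then show ?thesis
    by (simp add: o_def matrix_exp_scaleR_commute)
qed

text \<open>By the product rule and commutation the product has derivative zero, so it keeps its
  value at 0.\<close>

lemma matrix_exp_minus_inverse:
  fixes M :: "real^'n^'n"
  shows "matrix_exp (t *\<^sub>R M) ** matrix_exp (- t *\<^sub>R M) = mat 1"
proof -
  \<comment> \<open>Writing \<open>0 - s\<close> makes the second factor an instance of
    \<open>has_vector_derivative_matrix_exp_diff\<close> with \<open>T = 0\<close>.\<close>
  let ?f = "\<lambda>s. matrix_exp (s *\<^sub>R M) ** matrix_exp ((0 - s) *\<^sub>R M)"
  have "(?f has_vector_derivative 0) (at s)" for s
  proof -
    have "(?f has_vector_derivative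
        matrix_exp (s *\<^sub>R M) ** - (matrix_exp ((0 - s) *\<^sub>R M) ** M) +
        M ** matrix_exp (s *\<^sub>R M) ** matrix_exp ((0 - s) *\<^sub>R M)) (at s)"
      by (intro bounded_bilinear.has_vector_derivative[OF bounded_bilinear_matrix_matrix_mult]
          has_vector_derivative_matrix_exp_diff has_vector_derivative_matrix_exp_scaleR)
    moreover have "M ** matrix_exp (s *\<^sub>R M) ** matrix_exp ((0 - s) *\<^sub>R M) =
        matrix_exp (s *\<^sub>R M) ** (matrix_exp ((0 - s) *\<^sub>R M) ** M)"
      by (metis matrix_exp_scaleR_commute matrix_mul_assoc)
    ultimately show ?thesis
      by (simp add: bounded_bilinear.minus_right[OF bounded_bilinear_matrix_matrix_mult])
  qed
  then obtain c where c: "\<And>s. ?f s = c"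
    using has_vector_derivative_zero_constant[of UNIV ?f] by auto
  from c[of 0] c[of t] show ?thesis by simp
qed

section \<open>Variation of constants\<close>

text \<open>With the exponential of \<open>t *\<^sub>R P\<close> outside the integral, the integrand
  does not involve \<open>t\<close>, so the product rule and the fundamental theorem apply
  directly.\<close>

lemma linear_control_solution_exists:
  fixes P :: "real^'d^'d" and Q :: "real^'m^'d"
  assumes u: "continuous_on {0..T} u"
  shows "linear_control_solution P Q T u
    (\<lambda>t. matrix_exp (t *\<^sub>R P) *v (a + integral {0..t} (\<lambda>s. matrix_exp (- s *\<^sub>R P) *v (Q *v u s))))"
  unfolding linear_control_solution_iff_classical[OF u]
proof
  fix t assume t: "t \<in> {0..T}"
  let ?g = "\<lambda>s. matrix_exp (- s *\<^sub>R P) *v (Q *v u s)"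
  let ?I = "\<lambda>t. a + integral {0..t} ?g"
  have "continuous_on {0..T} ?g"
    using u by (intro continuous_intros)
  then have "((\<lambda>t. integral {0..t} ?g) has_vector_derivative ?g t) (at t within {0..T})"
    using t by (intro integral_has_vector_derivative)
  then have "(?I has_vector_derivative ?g t) (at t within {0..T})"
    by (auto intro!: derivative_eq_intros)
  then have "((\<lambda>t. matrix_exp (t *\<^sub>R P) *v ?I t) has_vector_derivative
      matrix_exp (t *\<^sub>R P) *v ?g t + (P ** matrix_exp (t *\<^sub>R P)) *v ?I t) (at t within {0..T})"
    by (intro bounded_bilinear.has_vector_derivative[OF bounded_bilinear_matrix_vector_mult]
        has_vector_derivative_at_within[OF has_vector_derivative_matrix_exp_scaleR])
  \<comment> \<open>The two opposite exponentials cancel, leaving the forcing term.\<close>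
  moreover have "matrix_exp (t *\<^sub>R P) *v ?g t = Q *v u t"
    using matrix_exp_minus_inverse[of t P]
    by (simp add: matrix_vector_mul_assoc matrix_mul_assoc)
  ultimately show "((\<lambda>t. matrix_exp (t *\<^sub>R P) *v ?I t) has_vector_derivative
      P *v (matrix_exp (t *\<^sub>R P) *v ?I t) + Q *v u t) (at t within {0..T})"
    by (simp add: matrix_vector_mul_assoc add.commute)
qed

text \<open>Differentiating \<open>exp((T - s)P) x(s)\<close> cancels the homogeneous part of the equation, so no
  separate uniqueness argument is needed.\<close>

lemma linear_control_solution_eq:
  fixes P :: "real^'d^'d" and Q :: "real^'m^'d"
  assumes T: "0 \<le> T" and u: "continuous_on {0..T} u" and x: "linear_control_solution P Q T u x"
  shows "x T = matrix_exp (T *\<^sub>R P) *v x 0 +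
    integral {0..T} (\<lambda>s. (matrix_exp ((T - s) *\<^sub>R P) ** Q) *v u s)"
proof -
  let ?E = "\<lambda>s. matrix_exp ((T - s) *\<^sub>R P)"
  have "((\<lambda>s. (?E s ** Q) *v u s) has_integral ?E T *v x T - ?E 0 *v x 0) {0..T}"
  proof (rule fundamental_theorem_of_calculus[OF T])
    fix s assume s: "s \<in> {0..T}"
    have "(x has_vector_derivative P *v x s + Q *v u s) (at s within {0..T})"
      using x s linear_control_solution_iff_classical[OF u] by blast
    then have "((\<lambda>s. ?E s *v x s) has_vector_derivative
        ?E s *v (P *v x s + Q *v u s) + (- (?E s ** P)) *v x s) (at s within {0..T})"
      by (intro bounded_bilinear.has_vector_derivative[OF bounded_bilinear_matrix_vector_mult]
          has_vector_derivative_matrix_exp_diff)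
    \<comment> \<open>The term \<open>?E s ** P\<close> acts on \<open>x s\<close> once with each
      sign, so only the control term survives.\<close>
    then show "((\<lambda>s. ?E s *v x s) has_vector_derivative (?E s ** Q) *v u s) (at s within {0..T})"
      by (simp add: matrix_vector_right_distrib matrix_vector_mul_assoc
          bounded_bilinear.minus_left[OF bounded_bilinear_matrix_vector_mult])
  qed
  \<comment> \<open>At \<open>T\<close> the factor \<open>?E\<close> is the identity, at 0 it is the
    exponential of \<open>T *\<^sub>R P\<close>.\<close>
  then show ?thesis
    by (simp add: integral_unique)
qed

section \<open>The averaged state\<close>

text \<open>Joint continuity is what the parameter integrals and the exchange of the integrals over
  \<open>s\<close> and \<open>\<theta>\<close> rest on.\<close>

lemma continuous_on_matrix_exp_times:
  fixes A :: "real \<Rightarrow> real^'d^'d" and B :: "real \<Rightarrow> real^'m^'d"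
  assumes "continuous_on {0..1} A" "continuous_on {0..1} B"
  shows "continuous_on (S \<times> {0..1}) (\<lambda>(s, \<theta>). matrix_exp ((T - s) *\<^sub>R A \<theta>) ** B \<theta>)"
  unfolding split_def
  by (intro continuous_intros continuous_on_compose2[OF assms(1) continuous_on_snd]
      continuous_on_compose2[OF assms(2) continuous_on_snd]) auto

lemma continuous_on_averaged_response:
  fixes A :: "real \<Rightarrow> real^'d^'d" and B :: "real \<Rightarrow> real^'m^'d"
  assumes "continuous_on {0..1} A" "continuous_on {0..1} B"
  shows "continuous_on S (averaged_response A B T)"
proof -
  have "continuous_on S (\<lambda>s. integral (cbox 0 1) (\<lambda>\<theta>. matrix_exp ((T - s) *\<^sub>R A \<theta>) ** B \<theta>))"
    using continuous_on_matrix_exp_times[OF assms, of S T]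
    by (intro integral_continuous_on_param) (simp add: cbox_interval)
  then show ?thesis
    unfolding averaged_response_def[abs_def] by (simp add: cbox_interval)
qed

lemma integral_matrix_vector_mult:
  fixes F :: "real \<Rightarrow> real^'n^'m"
  assumes "continuous_on {a..b} F"
  shows "integral {a..b} (\<lambda>s. F s *v v) = integral {a..b} F *v v"
  using integral_linear[OF integrable_continuous_real[OF assms],
      OF bounded_bilinear.bounded_linear_left[OF bounded_bilinear_matrix_vector_mult], of v]
  by (simp add: o_def)

text \<open>No regularity of the final state in \<open>\<theta>\<close> is assumed: it is read off
  from the closed formula for each member, which is continuous in \<open>\<theta>\<close>.\<close>

lemma average_linear_control_solution:
  fixes A :: "real \<Rightarrow> real^'d^'d" and B :: "real \<Rightarrow> real^'m^'d" and x :: "real \<Rightarrow> real \<Rightarrow> real^'d"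
  assumes T: "0 \<le> T" and A: "continuous_on {0..1} A" and B: "continuous_on {0..1} B"
    and u: "continuous_on {0..T} u"
    and x: "\<And>\<theta>. \<theta> \<in> {0..1} \<Longrightarrow> x 0 \<theta> = x\<^sub>0 \<and> linear_control_solution (A \<theta>) (B \<theta>) T u (\<lambda>t. x t \<theta>)"
  shows "continuous_on {0..1} (x T)"
    and "integral {0..1} (x T) = integral {0..1} (\<lambda>\<theta>. matrix_exp (T *\<^sub>R A \<theta>)) *v x\<^sub>0 +
      integral {0..T} (\<lambda>s. averaged_response A B T s *v u s)"
proof -
  let ?F = "\<lambda>s \<theta>. matrix_exp ((T - s) *\<^sub>R A \<theta>) ** B \<theta>"
  let ?h = "\<lambda>\<theta>. matrix_exp (T *\<^sub>R A \<theta>) *v x\<^sub>0"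
  let ?I = "\<lambda>\<theta>. integral {0..T} (\<lambda>s. ?F s \<theta> *v u s)"
  have F: "continuous_on ({0..T} \<times> {0..1}) (\<lambda>(s, \<theta>). ?F s \<theta> *v u s)"
    using continuous_on_matrix_exp_times[OF A B, of "{0..T}" T] unfolding split_def
    by (rule continuous_on_matrix_vector_mult)
      (rule continuous_on_compose2[OF u continuous_on_fst[OF continuous_on_id]], auto)
  have xT: "x T \<theta> = ?h \<theta> + ?I \<theta>" if "\<theta> \<in> {0..1}" for \<theta>
    using linear_control_solution_eq[OF T u, of "A \<theta>" "B \<theta>" "\<lambda>t. x t \<theta>"] x[OF that] by simp
  have E: "continuous_on {0..1} (\<lambda>\<theta>. matrix_exp (T *\<^sub>R A \<theta>))"
    using A by (intro continuous_intros)
  have h: "continuous_on {0..1} ?h"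
    using A by (intro continuous_intros)
  \<comment> \<open>Here \<open>\<theta>\<close> is the parameter and \<open>s\<close> the variable
    of integration, hence the swapped arguments.\<close>
  have "continuous_on ({0..1} \<times> cbox 0 T) (\<lambda>(\<theta>, s). ?F s \<theta> *v u s)"
    using continuous_on_swap_args[OF F] by (simp add: cbox_interval)
  then have I: "continuous_on {0..1} ?I"
    using integral_continuous_on_param by (fastforce simp: cbox_interval)
  have "continuous_on {0..1} (\<lambda>\<theta>. ?h \<theta> + ?I \<theta>)"
    using h I by (rule continuous_on_add)
  then show "continuous_on {0..1} (x T)"
    by (rule continuous_on_eq) (simp add: xT)
  have "integral {0..1} (x T) = integral {0..1} (\<lambda>\<theta>. ?h \<theta> + ?I \<theta>)"
    by (rule integral_cong) (rule xT)
  also have "\<dots> = integral {0..1} ?h + integral {0..1} ?I"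
    using h I by (intro integral_add integrable_continuous_real)
  also have "integral {0..1} ?h = integral {0..1} (\<lambda>\<theta>. matrix_exp (T *\<^sub>R A \<theta>)) *v x\<^sub>0"
    by (rule integral_matrix_vector_mult[OF E])
  \<comment> \<open>Fubini for a continuous integrand on the rectangle.\<close>
  also have "integral {0..1} ?I = integral {0..T} (\<lambda>s. integral {0..1} (\<lambda>\<theta>. ?F s \<theta> *v u s))"
    using integral_swap_continuous[of 0 0 T 1 "\<lambda>s \<theta>. ?F s \<theta> *v u s"] F
    by (simp add: cbox_Pair_eq)
  \<comment> \<open>The control is common to all members, so \<open>u s\<close> leaves the integral
    over \<open>\<theta>\<close> and the averaged response remains.\<close>
  also have "\<dots> = integral {0..T} (\<lambda>s. averaged_response A B T s *v u s)"
    unfolding averaged_response_def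
    using A B by (intro integral_cong integral_matrix_vector_mult continuous_intros)
  finally show "integral {0..1} (x T) = integral {0..1} (\<lambda>\<theta>. matrix_exp (T *\<^sub>R A \<theta>)) *v x\<^sub>0 +
      integral {0..T} (\<lambda>s. averaged_response A B T s *v u s)" .
qed

text \<open>Continuity of every control path lets Caratheodory solutions be treated as classical
  ones.\<close>

lemma continuous_on_averaged_control:
  assumes "continuous_on {0..1} A" "continuous_on {0..1} B"
  shows "continuous_on S (averaged_control A B T z)"
  unfolding averaged_control_def[abs_def] split_def
  by (intro continuous_intros continuous_on_averaged_response assms)

text \<open>\<open>matrix_inv\<close> is a choice of a two-sided inverse, and invertibility provides
  one to choose.\<close>

lemma matrix_inv_right: "invertible G \<Longrightarrow> G ** matrix_inv G = mat 1"
  unfolding invertible_def matrix_inv_def by (rule someI2_ex) auto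

text \<open>The control is the transposed response applied to a vector constant in time. That vector
  leaves the integral, and what remains is the Gramian, which cancels its inverse.\<close>

lemma averaged_control_steers:
  fixes A :: "real \<Rightarrow> real^'d^'d" and B :: "real \<Rightarrow> real^'m^'d"
  assumes A: "continuous_on {0..1} A" and B: "continuous_on {0..1} B"
    and G: "invertible (averaged_gramian A B T)"
  shows "integral {0..T} (\<lambda>s. averaged_response A B T s *v averaged_control A B T (x\<^sub>0, x\<^sub>f) s) =
    x\<^sub>f - integral {0..1} (\<lambda>\<theta>. matrix_exp (T *\<^sub>R A \<theta>)) *v x\<^sub>0"
proof -
  let ?\<Phi> = "averaged_response A B T" and ?G = "averaged_gramian A B T"
  let ?v = "x\<^sub>f - integral {0..1} (\<lambda>\<theta>. matrix_exp (T *\<^sub>R A \<theta>)) *v x\<^sub>0"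
  have "integral {0..T} (\<lambda>s. ?\<Phi> s *v averaged_control A B T (x\<^sub>0, x\<^sub>f) s) =
      integral {0..T} (\<lambda>s. (?\<Phi> s ** transpose (?\<Phi> s)) *v (matrix_inv ?G *v ?v))"
    by (simp add: averaged_control_def matrix_vector_mul_assoc matrix_mul_assoc)
  also have "\<dots> = ?G *v (matrix_inv ?G *v ?v)"
    unfolding averaged_gramian_def
    by (intro integral_matrix_vector_mult continuous_intros continuous_on_averaged_response A B)
  also have "\<dots> = ?v"
    using matrix_inv_right[OF G] by (simp add: matrix_vector_mul_assoc)
  finally show ?thesis .
qed

section \<open>Randomness\<close>

lemma square_integrable_on_continuous:
  fixes u :: "real \<Rightarrow> 'a::euclidean_space"
  assumes "continuous_on {a..b} u"
  shows "u square_integrable_on {a..b}"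
proof -
  have "(\<lambda>t. (norm (u t))\<^sup>2) absolutely_integrable_on {a..b}"
    using assms by (intro absolutely_integrable_continuous_real continuous_intros)
  then have "integrable (lebesgue_on {a..b}) (\<lambda>t. (norm (u t))\<^sup>2)"
    by (simp add: set_integrable_def integrable_restrict_space)
  then show ?thesis
    using assms unfolding square_integrable_on_def
    by (auto intro: continuous_imp_measurable_on_sets_lebesgue)
qed

text \<open>The control is a matrix depending on time alone applied to a vector depending on the
  sample alone. Each is measurable, and continuity of \<open>*v\<close> makes the combination
  jointly measurable.\<close>

lemma control_process_averaged_control:
  assumes A: "continuous_on {0..1} A" and B: "continuous_on {0..1} B"
    and z: "z \<in> borel_measurable M"
  shows "control_process M T (\<lambda>\<omega>. averaged_control A B T (z \<omega>))"
  unfolding control_process_def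
proof (intro conjI ballI)
  let ?N = "M \<Otimes>\<^sub>M restrict_space borel {0..T}"
  let ?K = "\<lambda>t. transpose (averaged_response A B T t) ** matrix_inv (averaged_gramian A B T)"
  let ?v = "\<lambda>z. snd z - integral {0..1} (\<lambda>\<theta>. matrix_exp (T *\<^sub>R A \<theta>)) *v fst z"
  have "continuous_on {0..T} ?K"
    by (intro continuous_intros continuous_on_averaged_response A B)
  then have "?K \<in> borel_measurable (restrict_space borel {0..T})"
    by (rule borel_measurable_continuous_on_restrict)
  then have K: "(\<lambda>p. ?K (snd p)) \<in> borel_measurable ?N"
    by (rule measurable_compose[OF measurable_snd])
  have "?v \<in> borel_measurable borel"
    by (intro borel_measurable_continuous_onI continuous_intros)
  then have "(\<lambda>p. ?v (z (fst p))) \<in> borel_measurable ?N"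
    by (rule measurable_compose[rotated]) (rule measurable_compose[OF measurable_fst z])
  with K have "(\<lambda>p. ?K (snd p) *v ?v (z (fst p))) \<in> borel_measurable ?N"
    by (rule borel_measurable_continuous_Pair) (intro continuous_intros)
  then show "(\<lambda>(\<omega>, t). averaged_control A B T (z \<omega>) t) \<in> borel_measurable ?N"
    by (simp add: averaged_control_def split_def)
qed (intro square_integrable_on_continuous continuous_on_averaged_control A B)

text \<open>Swapping the factors reduces this to \<open>distr_pair_fst\<close>. The factor
  integrated out is \<open>M\<close>, whose total mass is one; sigma-finiteness of \<open>N\<close>
  serves the swap.\<close>

lemma (in prob_space) distr_pair_snd:
  assumes "sigma_finite_measure N"
  shows "distr (M \<Otimes>\<^sub>M N) N snd = N"
proof -
  interpret N: sigma_finite_measure N by fact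
  interpret pair_sigma_finite M N ..
  have "distr (M \<Otimes>\<^sub>M N) N snd = distr (distr (N \<Otimes>\<^sub>M M) (M \<Otimes>\<^sub>M N) (\<lambda>(x, y). (y, x))) N snd"
    using pair_sigma_finite.distr_pair_swap[of M N] pair_sigma_finite_axioms by simp
  also have "\<dots> = distr (N \<Otimes>\<^sub>M M) N fst"
    by (subst distr_distr) (auto simp: o_def split_def)
  finally show ?thesis by (simp add: distr_pair_fst)
qed

lemma distr_marginals:
  fixes z :: "'w \<Rightarrow> 'a::topological_space \<times> 'b::topological_space"
  assumes z: "z \<in> borel_measurable M" and distr: "distr M borel z = \<mu> \<Otimes>\<^sub>M \<nu>"
    and \<mu>: "prob_space \<mu>" "sets \<mu> = sets borel" and \<nu>: "prob_space \<nu>" "sets \<nu> = sets borel"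
  shows "distr M borel (\<lambda>\<omega>. fst (z \<omega>)) = \<mu>" and "distr M borel (\<lambda>\<omega>. snd (z \<omega>)) = \<nu>"
proof -
  \<comment> \<open>\<open>z\<close> is measurable into the Borel sets of the product type, so the
    projections have to be measurable from there; continuity gives this for arbitrary topological
    spaces.\<close>
  have fst: "fst \<in> borel_measurable (borel :: ('a \<times> 'b) measure)"
    and snd: "snd \<in> borel_measurable (borel :: ('a \<times> 'b) measure)"
    by (intro borel_measurable_continuous_onI continuous_intros)+
  \<comment> \<open>As \<open>borel\<close> and \<open>\<mu>\<close> have the same measurable sets,
    either may be the target of \<open>distr\<close>.\<close>
  have "distr M borel (\<lambda>\<omega>. fst (z \<omega>)) = distr (\<mu> \<Otimes>\<^sub>M \<nu>) \<mu> fst"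
    using distr_distr[OF fst z] distr \<mu>(2) by (simp add: o_def cong: distr_cong)
  then show "distr M borel (\<lambda>\<omega>. fst (z \<omega>)) = \<mu>"
    using prob_space.distr_pair_fst[OF \<nu>(1)] by simp
  have "distr M borel (\<lambda>\<omega>. snd (z \<omega>)) = distr (\<mu> \<Otimes>\<^sub>M \<nu>) \<nu> snd"
    using distr_distr[OF snd z] distr \<nu>(2) by (simp add: o_def cong: distr_cong)
  then show "distr M borel (\<lambda>\<omega>. snd (z \<omega>)) = \<nu>"
    using prob_space.distr_pair_snd[OF \<mu>(1) prob_space_imp_sigma_finite[OF \<nu>(1)]] by simp
qed

theorem theorem3p1:
  fixes t\<^sub>f :: real
    and A :: "real \<Rightarrow> real^'d^'d"
    and B :: "real \<Rightarrow> real^'m^'d"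
    and \<mu>\<^sub>0 \<mu>\<^sub>f :: "(real^'d) measure"
    and M :: "'w measure"
    and z :: "'w \<Rightarrow> (real^'d) \<times> (real^'d)"
  assumes "t\<^sub>f > 0"
    and "continuous_on {0..1} A"
    and "continuous_on {0..1} B"
    and "prob_space \<mu>\<^sub>0" and "sets \<mu>\<^sub>0 = sets borel"
    and "prob_space \<mu>\<^sub>f" and "sets \<mu>\<^sub>f = sets borel"
    and "invertible (averaged_gramian A B t\<^sub>f)"
    and "prob_space M"
    and "z \<in> borel_measurable M"
    and "distr M borel z = \<mu>\<^sub>0 \<Otimes>\<^sub>M \<mu>\<^sub>f"
  shows "solves_averaged_control_problem A B t\<^sub>f \<mu>\<^sub>0 \<mu>\<^sub>f M
           (\<lambda>\<omega>. fst (z \<omega>)) (\<lambda>\<omega> t. averaged_control A B t\<^sub>f (z \<omega>) t)"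
proof -
  note A = assms(2) and B = assms(3) and z = assms(10)
  note marginals = distr_marginals[OF z assms(11,4-7)]
  let ?u = "\<lambda>\<omega>. averaged_control A B t\<^sub>f (z \<omega>)"
  have u: "continuous_on {0..t\<^sub>f} (?u \<omega>)" for \<omega>
    by (rule continuous_on_averaged_control[OF A B])
  have meas: "(\<lambda>\<omega>. fst (z \<omega>)) \<in> borel_measurable M" "(\<lambda>\<omega>. snd (z \<omega>)) \<in> borel_measurable M"
    by (intro measurable_compose[OF z] borel_measurable_continuous_onI continuous_intros)+
  \<comment> \<open>The variation of constants formula is taken for each sample and each
    \<open>\<theta>\<close>. At time 0 its integral vanishes and its exponential is the identity,
    which gives the initial condition.\<close>
  have "\<exists>X. ensemble_states A B t\<^sub>f M (\<lambda>\<omega>. fst (z \<omega>)) ?u X"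
    unfolding ensemble_states_def
    by (rule exI[of _ "\<lambda>\<omega> t \<theta>. matrix_exp (t *\<^sub>R A \<theta>) *v (fst (z \<omega>) +
          integral {0..t} (\<lambda>s. matrix_exp (- s *\<^sub>R A \<theta>) *v (B \<theta> *v ?u \<omega> s)))"])
      (intro ballI conjI linear_control_solution_exists u, simp)
  moreover have "(\<forall>\<omega>\<in>space M. X \<omega> t\<^sub>f absolutely_integrable_on {0..1}) \<and>
      (\<lambda>\<omega>. integral {0..1} (X \<omega> t\<^sub>f)) \<in> borel_measurable M \<and>
      distr M borel (\<lambda>\<omega>. integral {0..1} (X \<omega> t\<^sub>f)) = \<mu>\<^sub>f"
    if X: "ensemble_states A B t\<^sub>f M (\<lambda>\<omega>. fst (z \<omega>)) ?u X" for X
  proof -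
    \<comment> \<open>\<open>X\<close> is now an arbitrary family of states, not the one just
      constructed; the closed formula holds for every solution.\<close>
    have *: "continuous_on {0..1} (X \<omega> t\<^sub>f)" "integral {0..1} (X \<omega> t\<^sub>f) = snd (z \<omega>)"
      if \<omega>: "\<omega> \<in> space M" for \<omega>
    proof -
      have eq: "X \<omega> 0 \<theta> = fst (z \<omega>) \<and>
          linear_control_solution (A \<theta>) (B \<theta>) t\<^sub>f (?u \<omega>) (\<lambda>t. X \<omega> t \<theta>)" if "\<theta> \<in> {0..1}" for \<theta>
        using X \<omega> that unfolding ensemble_states_def by blast
      note average = average_linear_control_solution[OF less_imp_le[OF assms(1)] A B u eq]
      show "continuous_on {0..1} (X \<omega> t\<^sub>f)"
        by (rule average(1))
      show "integral {0..1} (X \<omega> t\<^sub>f) = snd (z \<omega>)"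
        using average(2) averaged_control_steers[OF A B assms(8), of "fst (z \<omega>)" "snd (z \<omega>)"]
        by simp
    qed
    have "distr M borel (\<lambda>\<omega>. integral {0..1} (X \<omega> t\<^sub>f)) = distr M borel (\<lambda>\<omega>. snd (z \<omega>))"
      by (rule distr_cong) (simp_all add: *)
    \<comment> \<open>Nothing is assumed about measurability of \<open>X\<close> in
      \<open>\<omega>\<close>; the average inherits it from \<open>snd (z \<omega>)\<close>, with
      which it agrees on \<open>space M\<close>.\<close>
    moreover have "(\<lambda>\<omega>. integral {0..1} (X \<omega> t\<^sub>f)) \<in> borel_measurable M"
      using meas(2) by (simp add: * cong: measurable_cong)
    ultimately show ?thesis
      using marginals(2) by (simp add: * absolutely_integrable_continuous_real)
  qed
  ultimately show ?thesis
    unfolding solves_averaged_control_problem_def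
    using control_process_averaged_control[OF A B z] meas(1) marginals(1) by blast
qed

end
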